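(* Let $a,b>0$ and let $E=\{(x,y)\in\mathbb{R}^2:\ x^2/a^2+y^2/b^2=1\}$. For a 3-periodic billiard trajectory in $E$, let $\theta_1,\theta_2,\theta_3$ be the interior angles of the triangle formed by its vertices. Then the sum $\cos\theta_1+\cos\theta_2+\cos\theta_3$ is the same for all 3-periodic billiard trajectories in $E$.
   Context: Elliptic billiard: a particle moves in straight lines at constant speed inside $E$ and bounces elastically on $E$, i.e. at each bounce point the incoming and outgoing segments make equal angles with the normal to $E$. A 3-periodic trajectory (orbit) is a closed billiard trajectory with three bounce points, that is, a non-degenerate triangle $P_1P_2P_3$ inscribed in $E$ such that at each vertex the normal to $E$ bisects the interior angle of the triangle. For a fixed ellipse $E$ these triangles form a one-parameter family (the 3-periodic family); a quantity is conserved by the family if it takes the same value on all of its members. *)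

theory Defs
  imports "HOL-Analysis.Analysis"
begin

definition ellipse :: "real \<Rightarrow> real \<Rightarrow> (real ^ 2) set" where
  "ellipse a b = {p. (p $ 1)\<^sup>2 / a\<^sup>2 + (p $ 2)\<^sup>2 / b\<^sup>2 = 1}"

(* Unoriented angle in [0, pi], used below for nonzero vectors only. *)
definition vec_angle :: "real ^ 2 \<Rightarrow> real ^ 2 \<Rightarrow> real" where
  "vec_angle u v = arccos ((u \<bullet> v) / (norm u * norm v))"

(* Interior angle at the middle point Q. *)
definition interior_angle :: "real ^ 2 \<Rightarrow> real ^ 2 \<Rightarrow> real ^ 2 \<Rightarrow> real" where
  "interior_angle P Q R = vec_angle (P - Q) (R - Q)"

(* Nonzero multiples, of either sign, of the gradient of x^2/a^2 + y^2/b^2 at p,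
   i.e. both the inner and the outer normal directions. *)
definition ellipse_normals :: "real \<Rightarrow> real \<Rightarrow> real ^ 2 \<Rightarrow> (real ^ 2) set" where
  "ellipse_normals a b p =
     {t *\<^sub>R vector [2 * (p $ 1) / a\<^sup>2, 2 * (p $ 2) / b\<^sup>2] | t. t \<noteq> 0}"

(* Requiring half the interior angle on both sides, rather than just equal angles,
   excludes the exterior bisector. *)
definition normal_bisects :: "real \<Rightarrow> real \<Rightarrow> real ^ 2 \<Rightarrow> real ^ 2 \<Rightarrow> real ^ 2 \<Rightarrow> bool" where
  "normal_bisects a b P Q R \<longleftrightarrow>
     (\<exists>n \<in> ellipse_normals a b Q.
        vec_angle (P - Q) n = interior_angle P Q R / 2 \<and>
        vec_angle (R - Q) n = interior_angle P Q R / 2)"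

definition three_periodic :: "real \<Rightarrow> real \<Rightarrow> real ^ 2 \<Rightarrow> real ^ 2 \<Rightarrow> real ^ 2 \<Rightarrow> bool" where
  "three_periodic a b P\<^sub>1 P\<^sub>2 P\<^sub>3 \<longleftrightarrow>
     P\<^sub>1 \<in> ellipse a b \<and> P\<^sub>2 \<in> ellipse a b \<and> P\<^sub>3 \<in> ellipse a b \<and>
     \<not> collinear {P\<^sub>1, P\<^sub>2, P\<^sub>3} \<and>
     normal_bisects a b P\<^sub>3 P\<^sub>1 P\<^sub>2 \<and>
     normal_bisects a b P\<^sub>1 P\<^sub>2 P\<^sub>3 \<and>
     normal_bisects a b P\<^sub>2 P\<^sub>3 P\<^sub>1"

definition cosine_sum :: "real ^ 2 \<Rightarrow> real ^ 2 \<Rightarrow> real ^ 2 \<Rightarrow> real" where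
  "cosine_sum P\<^sub>1 P\<^sub>2 P\<^sub>3 =
     cos (interior_angle P\<^sub>3 P\<^sub>1 P\<^sub>2) + cos (interior_angle P\<^sub>1 P\<^sub>2 P\<^sub>3) +
     cos (interior_angle P\<^sub>2 P\<^sub>3 P\<^sub>1)"

end

theory Submission
  imports Defs
begin

text \<open>Write \<open>A = diag(1/a\<^sup>2, 1/b\<^sup>2)\<close>. The reflection law makes Joachimsthal's quantity
  \<open>J = (1 - \<langle>AP, Q\<rangle>) / |PQ|\<close> the same on the three sides \<open>PQ\<close>, and
  \<open>cos \<theta> = 2J\<^sup>2/|AQ|\<^sup>2 - 1\<close> at each vertex \<open>Q\<close>. In the coordinates \<open>(c, s) = (x/a, y/b)\<close> the side
  condition factors into the bilinear equation \<open>\<alpha>cc' + \<beta>ss' = \<gamma>\<close>: the three points of the unit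
  circle form a triangle that is self-polar for the conic \<open>D = diag(\<alpha>, \<beta>, -\<gamma>)\<close>. Inverting
  \<open>X D X\<^sup>T = diag(d\<^sub>1, d\<^sub>2, d\<^sub>3)\<close> gives \<open>\<Sum> 1/d\<^sub>i = -1/\<gamma>\<close> and \<open>1/\<alpha> + 1/\<beta> + 1/\<gamma> = 0\<close>; the latter is a
  quadratic equation in \<open>J\<^sup>2\<close> with a single positive root, and since \<open>d\<^sub>i\<close> is proportional to
  \<open>|AP\<^sub>i|\<^sup>2\<close> the former turns the cosine sum into a function of \<open>a\<close>, \<open>b\<close> and \<open>J\<^sup>2\<close>.\<close>

definition joachimsthal :: "real \<Rightarrow> real \<Rightarrow> real ^ 2 \<Rightarrow> real ^ 2 \<Rightarrow> real" where
  "joachimsthal a b P Q = (1 - P $ 1 * Q $ 1 / a\<^sup>2 - P $ 2 * Q $ 2 / b\<^sup>2) / norm (P - Q)"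

text \<open>The squared length of \<open>A P\<close>, which is half the gradient of the ellipse's
  equation at \<open>P\<close>.\<close>

definition normal_sq :: "real \<Rightarrow> real \<Rightarrow> real ^ 2 \<Rightarrow> real" where
  "normal_sq a b P = (P $ 1 / a\<^sup>2)\<^sup>2 + (P $ 2 / b\<^sup>2)\<^sup>2"

lemma joachimsthal_commute: "joachimsthal a b P Q = joachimsthal a b Q P"
  by (simp add: joachimsthal_def norm_minus_commute mult.commute)

lemma inner_real2: "(u :: real ^ 2) \<bullet> v = u $ 1 * v $ 1 + u $ 2 * v $ 2"
  by (simp add: inner_vec_def sum_2)

lemma cos_vec_angle: "cos (vec_angle u v) = (u \<bullet> v) / (norm u * norm v)"
proof -
  have "\<bar>(u \<bullet> v) / (norm u * norm v)\<bar> \<le> 1"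
    using Cauchy_Schwarz_ineq2[of u v]
    by (cases "norm u * norm v = 0") (auto simp: abs_divide abs_mult divide_le_eq)
  then show ?thesis
    unfolding vec_angle_def by (rule cos_arccos_abs)
qed

lemma ellipse_iff:
  assumes "a > 0" "b > 0"
  shows "P \<in> ellipse a b \<longleftrightarrow> (P $ 1 / a)\<^sup>2 + (P $ 2 / b)\<^sup>2 = 1"
  by (simp add: ellipse_def power_divide)

text \<open>For \<open>Q\<close> on the ellipse, \<open>S - Q\<close> paired with the gradient at
  \<open>Q\<close> is \<open>-2\<close> times the numerator of \<open>joachimsthal a b S Q\<close>.
  So the cosine between a side at \<open>Q\<close> and the normal is that side's quantity times a
  factor common to both sides. Equal angles give the first claim, the double angle formula the
  second.\<close>

lemma normal_bisects_joachimsthal: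
  assumes a: "a > 0" and b: "b > 0" and Q: "Q \<in> ellipse a b"
    and PQ: "P \<noteq> Q" and RQ: "R \<noteq> Q" and bis: "normal_bisects a b P Q R"
  shows "joachimsthal a b P Q = joachimsthal a b Q R" (is ?eq)
    and "cos (interior_angle P Q R) = 2 * (joachimsthal a b P Q)\<^sup>2 / normal_sq a b Q - 1" (is ?cos)
proof -
  define g :: "real ^ 2" where "g = vector [2 * (Q $ 1) / a\<^sup>2, 2 * (Q $ 2) / b\<^sup>2]"
  obtain t where t: "t \<noteq> 0"
    and angP: "vec_angle (P - Q) (t *\<^sub>R g) = interior_angle P Q R / 2"
    and angR: "vec_angle (R - Q) (t *\<^sub>R g) = interior_angle P Q R / 2"
    using bis unfolding normal_bisects_def ellipse_normals_def g_def by blast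
  have g1: "g $ 1 = 2 * (Q $ 1) / a\<^sup>2" and g2: "g $ 2 = 2 * (Q $ 2) / b\<^sup>2"
    by (simp_all add: g_def)
  have norm_g: "(norm g)\<^sup>2 = 4 * normal_sq a b Q"
    unfolding power2_norm_eq_inner inner_real2 g1 g2 normal_sq_def
    by (simp add: power2_eq_square algebra_simps)
  have E: "(Q $ 1)\<^sup>2 / a\<^sup>2 + (Q $ 2)\<^sup>2 / b\<^sup>2 = 1"
    using Q by (simp add: ellipse_def)
  then have "g $ 1 \<noteq> 0 \<or> g $ 2 \<noteq> 0"
    using a b by (auto simp: g1 g2)
  then have g0: "g \<noteq> 0"
    by auto
  have inner_g: "(S - Q) \<bullet> g = - 2 * (1 - S $ 1 * Q $ 1 / a\<^sup>2 - S $ 2 * Q $ 2 / b\<^sup>2)" for S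
  proof -
    have "(S - Q) \<bullet> g = 2 * (S $ 1 * Q $ 1 / a\<^sup>2 + S $ 2 * Q $ 2 / b\<^sup>2)
        - 2 * ((Q $ 1)\<^sup>2 / a\<^sup>2 + (Q $ 2)\<^sup>2 / b\<^sup>2)"
      unfolding inner_real2 g1 g2
      by (simp add: algebra_simps power2_eq_square add_divide_distrib diff_divide_distrib)
    then show ?thesis
      by (simp add: E)
  qed
  \<comment> \<open>The factor is free of \<open>S\<close>, and \<open>t\<close> enters only through
    its sign, so inner and outer normals are treated at once.\<close>
  have k: "cos (vec_angle (S - Q) (t *\<^sub>R g)) = - 2 * sgn t / norm g * joachimsthal a b S Q" for S
  proof -
    have "(t * (- 2 * m)) / (r * (\<bar>t\<bar> * norm g)) = - 2 * (t / \<bar>t\<bar>) / norm g * (m / r)" for m r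
      by (simp add: mult_ac)
    then show ?thesis
      unfolding cos_vec_angle joachimsthal_def inner_scaleR_right norm_scaleR inner_g real_sgn_eq .
  qed
  have "- 2 * sgn t / norm g * joachimsthal a b P Q = - 2 * sgn t / norm g * joachimsthal a b R Q"
    unfolding k[symmetric] angP angR ..
  then show ?eq
    using t g0 by (simp add: sgn_if joachimsthal_commute[of a b Q R] split: if_splits)
  have "cos (interior_angle P Q R) = 2 * (cos (interior_angle P Q R / 2))\<^sup>2 - 1"
    using cos_double_cos[of "interior_angle P Q R / 2"] by simp
  also have "cos (interior_angle P Q R / 2) = - 2 * sgn t / norm g * joachimsthal a b P Q"
    using k[of P] angP by simp
  also have "2 * (- 2 * sgn t / norm g * joachimsthal a b P Q)\<^sup>2 - 1
      = 2 * (joachimsthal a b P Q)\<^sup>2 / normal_sq a b Q - 1"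
    using t by (simp add: power_mult_distrib power_divide norm_g sgn_if)
  finally show ?cos .
qed

text \<open>On the unit circle both sides of the hypothesis \<open>M\<^sup>2 = t|PQ|\<^sup>2\<close> are divisible by
  \<open>M = 1 - cc' - ss'\<close>, because \<open>(c - c')\<^sup>2 = M (1 - cc' + ss')\<close> and
  \<open>(s - s')\<^sup>2 = M (1 + cc' - ss')\<close>.\<close>

lemma chord_bilinear:
  fixes a b t c s c' s' :: real
  assumes u: "c\<^sup>2 + s\<^sup>2 = 1" and u': "c'\<^sup>2 + s'\<^sup>2 = 1" and ne: "(c, s) \<noteq> (c', s')"
    and M: "(1 - c * c' - s * s')\<^sup>2 = t * (a\<^sup>2 * (c - c')\<^sup>2 + b\<^sup>2 * (s - s')\<^sup>2)"
  shows "(1 + t * (b\<^sup>2 - a\<^sup>2)) * c * c' + (1 - t * (b\<^sup>2 - a\<^sup>2)) * s * s' = 1 - t * (a\<^sup>2 + b\<^sup>2)"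
proof -
  define m where "m = 1 - c * c' - s * s'"
  \<comment> \<open>\<open>m\<close> is half the squared chord of the unit circle, hence a nonzero
    factor that can be cancelled.\<close>
  have "2 * m = (c - c')\<^sup>2 + (s - s')\<^sup>2"
    using u u' unfolding m_def by (simp add: power2_eq_square algebra_simps)
  moreover have "(c - c')\<^sup>2 + (s - s')\<^sup>2 \<noteq> 0"
    using ne by (simp add: sum_power2_eq_zero_iff)
  ultimately have m0: "m \<noteq> 0"
    by auto
  have c: "(c - c')\<^sup>2 = m * (1 - c * c' + s * s')"
    using u u' unfolding m_def by algebra
  have s: "(s - s')\<^sup>2 = m * (1 + c * c' - s * s')"
    using u u' unfolding m_def by algebra
  have "m * m = m * (t * (a\<^sup>2 * (1 - c * c' + s * s') + b\<^sup>2 * (1 + c * c' - s * s')))"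
    using M unfolding c s m_def[symmetric] by (simp add: power2_eq_square algebra_simps)
  then have "m = t * (a\<^sup>2 * (1 - c * c' + s * s') + b\<^sup>2 * (1 + c * c' - s * s'))"
    using m0 by simp
  then show ?thesis
    unfolding m_def by (simp add: algebra_simps)
qed

text \<open>With the points \<open>(c, s, 1)\<close> as columns of \<open>X\<close>, the hypotheses
  read \<open>X^T D X = diag(d1, d2, d3)\<close>. Hence
  \<open>Y = diag(1/d1, 1/d2, 1/d3) X^T D\<close> is a left inverse of the square matrix
  \<open>X\<close>, thus also a right inverse, and the diagonal of \<open>X Y = 1\<close> is the
  conclusion.\<close>

lemma self_polar_dual:
  fixes \<alpha> \<beta> \<gamma> c1 c2 c3 s1 s2 s3 d1 d2 d3 :: real
  assumes 12: "\<alpha> * c1 * c2 + \<beta> * s1 * s2 = \<gamma>"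
    and 23: "\<alpha> * c2 * c3 + \<beta> * s2 * s3 = \<gamma>"
    and 31: "\<alpha> * c3 * c1 + \<beta> * s3 * s1 = \<gamma>"
    and d1: "\<alpha> * c1\<^sup>2 + \<beta> * s1\<^sup>2 - \<gamma> = d1"
    and d2: "\<alpha> * c2\<^sup>2 + \<beta> * s2\<^sup>2 - \<gamma> = d2"
    and d3: "\<alpha> * c3\<^sup>2 + \<beta> * s3\<^sup>2 - \<gamma> = d3"
    and nz: "d1 \<noteq> 0" "d2 \<noteq> 0" "d3 \<noteq> 0"
  shows "\<alpha> * (c1\<^sup>2 / d1 + c2\<^sup>2 / d2 + c3\<^sup>2 / d3) = 1"
    and "\<beta> * (s1\<^sup>2 / d1 + s2\<^sup>2 / d2 + s3\<^sup>2 / d3) = 1"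
    and "- \<gamma> * (1 / d1 + 1 / d2 + 1 / d3) = 1"
proof -
  define Y :: "real ^ 3 ^ 3" where
    "Y = vector [vector [\<alpha> * c1 / d1, \<beta> * s1 / d1, - \<gamma> / d1],
                 vector [\<alpha> * c2 / d2, \<beta> * s2 / d2, - \<gamma> / d2],
                 vector [\<alpha> * c3 / d3, \<beta> * s3 / d3, - \<gamma> / d3]]"
  define X :: "real ^ 3 ^ 3" where
    "X = vector [vector [c1, c2, c3], vector [s1, s2, s3], vector [1, 1, 1]]"
  have "Y ** X = mat 1"
    using assms
    by (simp add: vec_eq_iff forall_3 matrix_matrix_mult_def mat_def sum_3 X_def Y_def
        divide_simps) (simp add: power2_eq_square algebra_simps)
  then have "X ** Y = mat 1"
    by (simp add: matrix_left_right_inverse)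
  then have "c1 * (\<alpha> * c1 / d1) + c2 * (\<alpha> * c2 / d2) + c3 * (\<alpha> * c3 / d3) = 1"
    "s1 * (\<beta> * s1 / d1) + s2 * (\<beta> * s2 / d2) + s3 * (\<beta> * s3 / d3) = 1"
    "- \<gamma> / d1 + - \<gamma> / d2 + - \<gamma> / d3 = 1"
    by (simp_all add: vec_eq_iff forall_3 matrix_matrix_mult_def mat_def sum_3 X_def Y_def)
  then show "\<alpha> * (c1\<^sup>2 / d1 + c2\<^sup>2 / d2 + c3\<^sup>2 / d3) = 1"
    "\<beta> * (s1\<^sup>2 / d1 + s2\<^sup>2 / d2 + s3\<^sup>2 / d3) = 1"
    "- \<gamma> * (1 / d1 + 1 / d2 + 1 / d3) = 1"
    by (simp_all add: power2_eq_square algebra_simps)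
qed

text \<open>Here \<open>t\<close> is the square of the common Joachimsthal quantity. Both equations
  involve the orbit through \<open>t\<close> alone, so the invariance reduces to uniqueness of a
  positive root.\<close>

lemma three_periodic_cosine_sum:
  assumes a: "a > 0" and b: "b > 0" and per: "three_periodic a b P\<^sub>1 P\<^sub>2 P\<^sub>3"
  obtains t where "t > 0" "3 - 2 * (a\<^sup>2 + b\<^sup>2) * t - (b\<^sup>2 - a\<^sup>2)\<^sup>2 * t\<^sup>2 = 0"
    "cosine_sum P\<^sub>1 P\<^sub>2 P\<^sub>3 = 4 * t\<^sup>2 * a\<^sup>2 * b\<^sup>2 / ((a\<^sup>2 + b\<^sup>2) * t - 1) - 3"
proof -
  have E: "P\<^sub>1 \<in> ellipse a b" "P\<^sub>2 \<in> ellipse a b" "P\<^sub>3 \<in> ellipse a b"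
    and bis: "normal_bisects a b P\<^sub>3 P\<^sub>1 P\<^sub>2" "normal_bisects a b P\<^sub>1 P\<^sub>2 P\<^sub>3"
      "normal_bisects a b P\<^sub>2 P\<^sub>3 P\<^sub>1"
    and nc: "\<not> collinear {P\<^sub>1, P\<^sub>2, P\<^sub>3}"
    using per by (auto simp: three_periodic_def)
  have ne: "P\<^sub>1 \<noteq> P\<^sub>2" "P\<^sub>2 \<noteq> P\<^sub>3" "P\<^sub>3 \<noteq> P\<^sub>1"
    using nc by (auto simp: insert_commute)
  define J where "J = joachimsthal a b P\<^sub>1 P\<^sub>2"
  define t where "t = J\<^sup>2"
  have J12: "joachimsthal a b P\<^sub>1 P\<^sub>2 = J" and J23: "joachimsthal a b P\<^sub>2 P\<^sub>3 = J"
    and J31: "joachimsthal a b P\<^sub>3 P\<^sub>1 = J"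
    using normal_bisects_joachimsthal(1)[OF a b E(1) ne(3) ne(1)[symmetric] bis(1)]
      normal_bisects_joachimsthal(1)[OF a b E(2) ne(1) ne(2)[symmetric] bis(2)]
    by (simp_all add: J_def)
  define c s where "c P = P $ 1 / a" and "s P = P $ 2 / b" for P :: "real ^ 2"
  have coord: "P $ 1 = a * c P" "P $ 2 = b * s P" for P :: "real ^ 2"
    using a b by (simp_all add: c_def s_def)
  have u: "(c P)\<^sup>2 + (s P)\<^sup>2 = 1" if "P \<in> ellipse a b" for P
    using that ellipse_iff[OF a b] by (simp add: c_def s_def)
  \<comment> \<open>The diagonal entry of the form at \<open>P\<close>, rewritten with
    \<open>c\<^sup>2 + s\<^sup>2 = 1\<close> so that its sign and its proportionality to
    \<open>normal_sq\<close> are visible.\<close>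
  define d where "d P = 2 * t * (a\<^sup>2 * (s P)\<^sup>2 + b\<^sup>2 * (c P)\<^sup>2)" for P
  define \<alpha> \<beta> \<gamma> where "\<alpha> = 1 + t * (b\<^sup>2 - a\<^sup>2)" and "\<beta> = 1 - t * (b\<^sup>2 - a\<^sup>2)"
    and "\<gamma> = 1 - t * (a\<^sup>2 + b\<^sup>2)"
  have chord: "(1 - c P * c Q - s P * s Q)\<^sup>2
      = t * (a\<^sup>2 * (c P - c Q)\<^sup>2 + b\<^sup>2 * (s P - s Q)\<^sup>2)"
    if "joachimsthal a b P Q = J" "P \<noteq> Q" for P Q
  proof -
    have "(norm (P - Q))\<^sup>2 = a\<^sup>2 * (c P - c Q)\<^sup>2 + b\<^sup>2 * (s P - s Q)\<^sup>2"
      unfolding power2_norm_eq_inner inner_real2 vector_minus_component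
        coord[of P] coord[of Q]
      by (simp add: power2_eq_square algebra_simps)
    moreover have "1 - P $ 1 * Q $ 1 / a\<^sup>2 - P $ 2 * Q $ 2 / b\<^sup>2 = 1 - c P * c Q - s P * s Q"
      by (simp add: c_def s_def power2_eq_square)
    moreover have "1 - P $ 1 * Q $ 1 / a\<^sup>2 - P $ 2 * Q $ 2 / b\<^sup>2 = J * norm (P - Q)"
      using that by (auto simp: joachimsthal_def)
    ultimately show ?thesis
      by (metis t_def power_mult_distrib)
  qed
  have pair_ne: "(c P, s P) \<noteq> (c Q, s Q)" if "P \<noteq> Q" for P Q
    using that by (auto simp: vec_eq_iff forall_2 coord)
  have polar: "\<alpha> * c P * c Q + \<beta> * s P * s Q = \<gamma>"
    if "P \<in> ellipse a b" "Q \<in> ellipse a b" "P \<noteq> Q" "joachimsthal a b P Q = J" for P Q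
    unfolding \<alpha>_def \<beta>_def \<gamma>_def
    using chord_bilinear[OF u u pair_ne chord] that by blast
  have d: "\<alpha> * (c P)\<^sup>2 + \<beta> * (s P)\<^sup>2 - \<gamma> = d P" if "P \<in> ellipse a b" for P
    using u[OF that] unfolding d_def \<alpha>_def \<beta>_def \<gamma>_def by algebra
  \<comment> \<open>A vanishing \<open>J\<close> would make the squared chord of two distinct points
    zero.\<close>
  have "J \<noteq> 0"
  proof
    assume "J = 0"
    then have "1 - c P\<^sub>1 * c P\<^sub>2 - s P\<^sub>1 * s P\<^sub>2 = 0"
      using chord[OF J12 ne(1)] by (simp add: t_def)
    then have "(c P\<^sub>1 - c P\<^sub>2)\<^sup>2 + (s P\<^sub>1 - s P\<^sub>2)\<^sup>2 = 0"
      using u[OF E(1)] u[OF E(2)] by (simp add: power2_eq_square algebra_simps)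
    then show False
      using pair_ne[OF ne(1)] by (simp add: sum_power2_eq_zero_iff)
  qed
  then have t: "t > 0"
    by (simp add: t_def)
  have pos: "a\<^sup>2 * (s P)\<^sup>2 + b\<^sup>2 * (c P)\<^sup>2 \<noteq> 0" if "P \<in> ellipse a b" for P
    using u[OF that] a b by (auto simp: add_nonneg_eq_0_iff)
  then have d0: "d P \<noteq> 0" if "P \<in> ellipse a b" for P
    using that t by (simp add: d_def)
  have nsq: "normal_sq a b P = d P / (2 * t * a\<^sup>2 * b\<^sup>2)" for P
    using a b t unfolding normal_sq_def d_def coord
    by (simp add: power2_eq_square field_simps)
  have cos_eq: "2 * J\<^sup>2 / normal_sq a b P - 1 = 4 * t\<^sup>2 * a\<^sup>2 * b\<^sup>2 * (1 / d P) - 1" for P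
    by (simp add: nsq t_def power2_eq_square)
  define \<sigma> where "\<sigma> = 1 / d P\<^sub>1 + 1 / d P\<^sub>2 + 1 / d P\<^sub>3"
  have S: "cosine_sum P\<^sub>1 P\<^sub>2 P\<^sub>3 = 4 * t\<^sup>2 * a\<^sup>2 * b\<^sup>2 * \<sigma> - 3"
    using normal_bisects_joachimsthal(2)[OF a b E(1) ne(3) ne(1)[symmetric] bis(1)]
      normal_bisects_joachimsthal(2)[OF a b E(2) ne(1) ne(2)[symmetric] bis(2)]
      normal_bisects_joachimsthal(2)[OF a b E(3) ne(2) ne(3)[symmetric] bis(3)]
    unfolding J12 J23 J31 cos_eq cosine_sum_def \<sigma>_def by (simp only: distrib_left)
  note dual = self_polar_dual[OF polar[OF E(1,2) ne(1) J12] polar[OF E(2,3) ne(2) J23]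
      polar[OF E(3,1) ne(3) J31] d[OF E(1)] d[OF E(2)] d[OF E(3)] d0[OF E(1)] d0[OF E(2)] d0[OF E(3)]]
  define p q where "p = (c P\<^sub>1)\<^sup>2 / d P\<^sub>1 + (c P\<^sub>2)\<^sup>2 / d P\<^sub>2 + (c P\<^sub>3)\<^sup>2 / d P\<^sub>3"
    and "q = (s P\<^sub>1)\<^sup>2 / d P\<^sub>1 + (s P\<^sub>2)\<^sup>2 / d P\<^sub>2 + (s P\<^sub>3)\<^sup>2 / d P\<^sub>3"
  have ap: "\<alpha> * p = 1" and bq: "\<beta> * q = 1" and gs: "- \<gamma> * \<sigma> = 1"
    using dual by (simp_all only: p_def q_def \<sigma>_def)
  have "p + q = ((c P\<^sub>1)\<^sup>2 + (s P\<^sub>1)\<^sup>2) / d P\<^sub>1 + ((c P\<^sub>2)\<^sup>2 + (s P\<^sub>2)\<^sup>2) / d P\<^sub>2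
      + ((c P\<^sub>3)\<^sup>2 + (s P\<^sub>3)\<^sup>2) / d P\<^sub>3"
    unfolding p_def q_def add_divide_distrib by simp
  then have pq: "p + q = \<sigma>"
    using u[OF E(1)] u[OF E(2)] u[OF E(3)] by (simp add: \<sigma>_def)
  \<comment> \<open>This is \<open>p + q = \<sigma>\<close> multiplied by
    \<open>\<alpha> * \<beta> * \<gamma>\<close>, that is,
    \<open>1/\<alpha> + 1/\<beta> + 1/\<gamma> = 0\<close> with denominators cleared.\<close>
  have "(\<alpha> + \<beta>) * \<gamma> + \<alpha> * \<beta> = 0"
    using ap bq gs pq by algebra
  then have quad: "3 - 2 * (a\<^sup>2 + b\<^sup>2) * t - (b\<^sup>2 - a\<^sup>2)\<^sup>2 * t\<^sup>2 = 0"
    unfolding \<alpha>_def \<beta>_def \<gamma>_def by (simp add: power2_eq_square algebra_simps)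
  have "((a\<^sup>2 + b\<^sup>2) * t - 1) * \<sigma> = 1"
    using gs by (simp add: \<gamma>_def algebra_simps)
  then have "\<sigma> = 1 / ((a\<^sup>2 + b\<^sup>2) * t - 1)"
    by (metis mult_zero_left nonzero_mult_div_cancel_left zero_neq_one)
  then show thesis
    using that[OF t quad] S by simp
qed

text \<open>Subtracting the equations leaves \<open>t - u\<close> times a positive factor. The case
  \<open>m = 0\<close> is included because it is the circle \<open>a = b\<close>.\<close>

lemma positive_root_unique:
  fixes k m t u :: real
  assumes "k > 0" "m \<ge> 0" "t > 0" "u > 0"
    and "3 - k * t - m * t\<^sup>2 = 0" "3 - k * u - m * u\<^sup>2 = 0"
  shows "t = u"
proof -
  have "(t - u) * (k + m * (t + u)) = 0"
    using assms(5,6) by algebra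
  moreover have "k + m * (t + u) > 0"
    using assms by (intro add_pos_nonneg) auto
  ultimately show ?thesis
    by auto
qed

theorem corollary2:
  fixes a b :: real and P\<^sub>1 P\<^sub>2 P\<^sub>3 Q\<^sub>1 Q\<^sub>2 Q\<^sub>3 :: "real ^ 2"
  assumes "a > 0" and "b > 0"
    and "three_periodic a b P\<^sub>1 P\<^sub>2 P\<^sub>3"
    and "three_periodic a b Q\<^sub>1 Q\<^sub>2 Q\<^sub>3"
  shows "cosine_sum P\<^sub>1 P\<^sub>2 P\<^sub>3 = cosine_sum Q\<^sub>1 Q\<^sub>2 Q\<^sub>3"
proof -
  obtain t where t: "t > 0" "3 - 2 * (a\<^sup>2 + b\<^sup>2) * t - (b\<^sup>2 - a\<^sup>2)\<^sup>2 * t\<^sup>2 = 0"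
    "cosine_sum P\<^sub>1 P\<^sub>2 P\<^sub>3 = 4 * t\<^sup>2 * a\<^sup>2 * b\<^sup>2 / ((a\<^sup>2 + b\<^sup>2) * t - 1) - 3"
    using three_periodic_cosine_sum[OF assms(1-3)] .
  obtain u where u: "u > 0" "3 - 2 * (a\<^sup>2 + b\<^sup>2) * u - (b\<^sup>2 - a\<^sup>2)\<^sup>2 * u\<^sup>2 = 0"
    "cosine_sum Q\<^sub>1 Q\<^sub>2 Q\<^sub>3 = 4 * u\<^sup>2 * a\<^sup>2 * b\<^sup>2 / ((a\<^sup>2 + b\<^sup>2) * u - 1) - 3"
    using three_periodic_cosine_sum[OF assms(1,2,4)] .
  have "2 * (a\<^sup>2 + b\<^sup>2) > 0"
    using assms(1,2) by (simp add: add_pos_pos)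
  then have "t = u"
    using positive_root_unique[OF _ _ t(1) u(1) t(2) u(2)] by simp
  then show ?thesis
    using t(3) u(3) by simp
qed

end
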